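(* Assume that for all $i\in\mathcal I$, $H(i,\cdot)$ is (strictly) increasing with respect to each coordinate. Let $\gamma\in\mathbb R$ be the ergodic constant $\gamma=\lim_{r\to0,\,r>0}r\,u^r_i$. Let $(v_i)_{i\in\mathcal I}\in\mathbb R^N$ and $(w_i)_{i\in\mathcal I}\in\mathbb R^N$ be such that $$-\gamma+H\big(i,(v_j-v_i)_{j\in\mathcal V(i)}\big)=0,\quad\forall i\in\mathcal I,$$ $$-\gamma+H\big(i,(w_j-w_i)_{j\in\mathcal V(i)}\big)=0,\quad\forall i\in\mathcal I.$$ Then there exists $C\in\mathbb R$ such that $w_i=v_i+C$ for all $i\in\mathcal I$.
   Context: $\mathcal I=\{1,\dots,N\}$ is the set of nodes of a finite strongly connected directed graph $\mathcal G$ (for any two nodes $i,j$ there is a directed path from $i$ to $j$). For $i\in\mathcal I$, $\mathcal V(i)\subset\mathcal I\setminus\{i\}$ is the set of nodes $j$ for which there is a directed edge from $i$ to $j$. $\mathbb R_+=[0,\infty)$, $\mathbb R_+^*=(0,\infty)$. For each $i\in\mathcal I$ a cost function $L(i,\cdot):\mathbb R_+^{|\mathcal V(i)|}\to\mathbb R\cup\{+\infty\}$ is given, with: (A1) for every $i$ there is a tuple $(\lambda_{ij})_{j\in\mathcal V(i)}$ with all entries in $\mathbb R_+^*$ such that $L(i,(\lambda_{ij})_j)<+\infty$; (A2) each $L(i,\cdot)$ is lower semi-continuous; (A3) there is $\underline C\in\mathbb R$ with $L(i,\lambda)\ge\underline C$ for all $i$ and all $\lambda\in\mathbb R_+^{|\mathcal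 V(i)|}$; (A4) for every $i$, $L(i,\lambda)/\|\lambda\|_\infty\to+\infty$ as $\|\lambda\|_\infty\to+\infty$. The Hamiltonian functions are $H(i,p)=\sup_{\lambda\in\mathbb R_+^{|\mathcal V(i)|}}\big(\sum_{j\in\mathcal V(i)}\lambda_{j}p_j-L(i,\lambda)\big)$ for $p\in\mathbb R^{|\mathcal V(i)|}$; they are real-valued. A terminal payoff $g:\mathcal I\to\mathbb R$ is fixed. All processes are defined on a filtered probability space satisfying the usual conditions and are adapted. For $0\le t\le T$, $\mathcal A^T_t$ is the set of families $(\lambda_s(i,j))_{s\in[t,T],i\in\mathcal I,j\in\mathcal V(i)}$ of non-negative deterministic functions with $s\mapsto\lambda_s(i,j)\in L^1(t,T)$ for all $i,j$. For $\lambda\in\mathcal A^T_t$, $(X^{t,i,\lambda}_s)_{s\in[t,T]}$ is the continuous-time Markov chain on $\mathcal I$ starting from node $i$ at time $t$ whose instantaneous transition rate at time $s$ from $k$ to $j\in\mathcal V(k)$ is $\lambda_s(k,j)$. For $r\ge0$, $$u^{T,r}_i(t)=\sup_{\lambda\in\mathcal A^T_t}\mathbb E\left[-\int_t^Te^{-r(s-t)}L\Big(X^{t,i,\lambda}_s,\big(\lambda_s(X^{t,i,\lambda}_s,j)\big)_{j\in\mathcal V(X^{t,i,\lambda}_s)}\Big)ds+e^{-r(T-t)}g\big(X^{t,i,\lambda}_T\big)\right].$$ For $r>0$ and $i\in\mathcal I$, $u^r_i=\lim_{T\to+\infty}u^{T,r}_i(t)\in\mathbb R$; this limit exists and does not depend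 on $t\in\mathbb R_+$. The limit $\gamma=\lim_{r\to0}ru^r_i$ exists in $\mathbb R$ and does not depend on $i\in\mathcal I$. *)

theory Defs
  imports "HOL-Probability.Probability"
begin

text \<open>
  The node set is a finite type \<open>'n\<close>, and \<open>V i\<close> is the set of out-neighbours of \<open>i\<close>.  The domain
  of \<open>L i\<close> is the set of non-negative tuples indexed by \<open>V i\<close>, encoded as extensional functions;
  its topology is that of the product space \<open>'n \<Rightarrow> real\<close>, relativised.
\<close>

definition intensities :: "('n \<Rightarrow> 'n set) \<Rightarrow> 'n \<Rightarrow> ('n \<Rightarrow> real) set" where
  "intensities V i = V i \<rightarrow>\<^sub>E {0..}"

text \<open>The inserted \<open>0\<close> only matters when \<open>V i\<close> is empty (a graph with a single node).\<close>

definition sup_norm :: "('n::finite \<Rightarrow> 'n set) \<Rightarrow> 'n \<Rightarrow> ('n \<Rightarrow> real) \<Rightarrow> real" where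
  "sup_norm V i l = Max (insert 0 ((\<lambda>j. \<bar>l j\<bar>) ` V i))"

text \<open>
  \<open>L\<close> never takes the value \<open>-\<infinity>\<close> on its domain, by \<open>bounded_below\<close>.
\<close>

locale controlled_graph =
  fixes V :: "'n::finite \<Rightarrow> 'n set"
    and L :: "'n \<Rightarrow> ('n \<Rightarrow> real) \<Rightarrow> ereal"
  assumes no_loop: "\<And>i. i \<notin> V i"
    and strongly_connected: "\<And>i j. (i, j) \<in> {(k, l). l \<in> V k}\<^sup>*"
    and finite_somewhere: "\<And>i. \<exists>l \<in> intensities V i. (\<forall>j\<in>V i. 0 < l j) \<and> L i l < \<infinity>"
    and lower_semicontinuous:
      "\<And>i l. l \<in> intensities V i \<Longrightarrow> L i l \<le> Liminf (at l within intensities V i) (L i)"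
    and bounded_below: "\<exists>C::real. \<forall>i. \<forall>l \<in> intensities V i. ereal C \<le> L i l"
    and superlinear:
      "\<And>i. ((\<lambda>l. L i l / ereal (sup_norm V i l)) \<longlongrightarrow> \<infinity>)
             (inf (filtercomap (sup_norm V i) at_top) (principal (intensities V i)))"

text \<open>Only the coordinates \<open>p j\<close> with \<open>j \<in> V i\<close> enter \<open>hamiltonian V L i p\<close>.\<close>

definition hamiltonian ::
  "('n \<Rightarrow> 'n set) \<Rightarrow> ('n \<Rightarrow> ('n \<Rightarrow> real) \<Rightarrow> ereal) \<Rightarrow> 'n \<Rightarrow> ('n \<Rightarrow> real) \<Rightarrow> ereal" where
  "hamiltonian V L i p = (SUP l \<in> intensities V i. ereal (\<Sum>j\<in>V i. l j * p j) - L i l)"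

text \<open>
  Filtrations are indexed by all reals in order to use the library locale; only the indices
  \<open>s \<ge> 0\<close> are relevant.
\<close>

locale usual_filtered_prob_space = prob_space M + filtration "space M" F
  for M :: "'w measure" and F :: "real \<Rightarrow> 'w measure" +
  assumes subalgebra_F: "\<And>s. 0 \<le> s \<Longrightarrow> subalgebra M (F s)"
    and right_continuous: "\<And>s. 0 \<le> s \<Longrightarrow> sets (F s) = (\<Inter>u\<in>{s<..}. sets (F u))"
    and complete: "\<And>A N. A \<subseteq> N \<Longrightarrow> N \<in> null_sets M \<Longrightarrow> A \<in> sets (F 0)"

text \<open>
  A control is a family \<open>a s i j\<close> of intensities; its values outside \<open>s \<in> {t..T}\<close>, \<open>j \<in> V i\<close> are
  never used.
\<close>

definition controls :: "('n \<Rightarrow> 'n set) \<Rightarrow> real \<Rightarrow> real \<Rightarrow> (real \<Rightarrow> 'n \<Rightarrow> 'n \<Rightarrow> real) set" where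
  "controls V t T = {a. \<forall>i. \<forall>j\<in>V i.
     (\<forall>s\<in>{t..T}. 0 \<le> a s i j) \<and> (\<lambda>s. a s i j) absolutely_integrable_on {t..T}}"

definition rate_matrix :: "('n \<Rightarrow> 'n set) \<Rightarrow> ('n \<Rightarrow> 'n \<Rightarrow> real) \<Rightarrow> 'n \<Rightarrow> 'n \<Rightarrow> real" where
  "rate_matrix V a k j =
     (if j = k then - (\<Sum>l\<in>V k. a k l) else if j \<in> V k then a k j else 0)"

text \<open>
  \<open>P s u k j\<close> is the probability to be in \<open>j\<close> at time \<open>u\<close> when in \<open>k\<close> at time \<open>s\<close>.  As the rates are
  only integrable in time, the Kolmogorov equation \<open>\<partial>P/\<partial>u = P Q\<^sub>u\<close>, \<open>P s s = I\<close>, which says that \<open>Q\<^sub>u\<close>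
  gives the instantaneous transition rates, is stated in integrated form.  It has exactly one
  solution, and that solution is stochastic.
\<close>

definition transition_probabilities ::
  "('n::finite \<Rightarrow> 'n set) \<Rightarrow> (real \<Rightarrow> 'n \<Rightarrow> 'n \<Rightarrow> real) \<Rightarrow> real \<Rightarrow> real
    \<Rightarrow> (real \<Rightarrow> real \<Rightarrow> 'n \<Rightarrow> 'n \<Rightarrow> real) \<Rightarrow> bool" where
  "transition_probabilities V a t T P \<longleftrightarrow> (\<forall>s u k j. t \<le> s \<and> s \<le> u \<and> u \<le> T \<longrightarrow>
     (\<lambda>z. \<Sum>l\<in>UNIV. P s z k l * rate_matrix V (a z) l j) absolutely_integrable_on {s..u} \<and>
     P s u k j = (if j = k then 1 else 0) +
       integral {s..u} (\<lambda>z. \<Sum>l\<in>UNIV. P s z k l * rate_matrix V (a z) l j))"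

text \<open>
  An adapted continuous-time Markov chain on \<open>{t..T}\<close> with initial node \<open>i\<close> and rates \<open>a\<close>.  Path
  regularity is with respect to the discrete topology of \<open>'n\<close>: right-continuous with left limits.
\<close>

definition markov_chain ::
  "'w measure \<Rightarrow> (real \<Rightarrow> 'w measure) \<Rightarrow> ('n::finite \<Rightarrow> 'n set) \<Rightarrow> (real \<Rightarrow> 'n \<Rightarrow> 'n \<Rightarrow> real)
    \<Rightarrow> real \<Rightarrow> real \<Rightarrow> 'n \<Rightarrow> (real \<Rightarrow> 'w \<Rightarrow> 'n) \<Rightarrow> bool" where
  "markov_chain M F V a t T i Y \<longleftrightarrow>
     (\<forall>s\<in>{t..T}. Y s \<in> measurable (F s) (count_space UNIV)) \<and>
     (AE \<omega> in M. Y t \<omega> = i) \<and>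
     (AE \<omega> in M. (\<forall>s\<in>{t..<T}. \<forall>\<^sub>F u in at_right s. Y u \<omega> = Y s \<omega>) \<and>
                 (\<forall>s\<in>{t<..T}. \<exists>k. \<forall>\<^sub>F u in at_left s. Y u \<omega> = k)) \<and>
     (\<exists>P. transition_probabilities V a t T P \<and>
       (\<forall>s u j. t \<le> s \<and> s \<le> u \<and> u \<le> T \<longrightarrow>
         (AE \<omega> in M. real_cond_exp M (F s) (\<lambda>\<omega>'. indicator {j} (Y u \<omega>')) \<omega> = P s u (Y s \<omega>) j)))"

text \<open>\<open>X T t i a\<close> is the chain started from \<open>i\<close> at time \<open>t\<close> and controlled by \<open>a \<in> controls V t T\<close>.\<close>

definition controlled_chains ::
  "'w measure \<Rightarrow> (real \<Rightarrow> 'w measure) \<Rightarrow> ('n::finite \<Rightarrow> 'n set)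
    \<Rightarrow> (real \<Rightarrow> real \<Rightarrow> 'n \<Rightarrow> (real \<Rightarrow> 'n \<Rightarrow> 'n \<Rightarrow> real) \<Rightarrow> real \<Rightarrow> 'w \<Rightarrow> 'n) \<Rightarrow> bool" where
  "controlled_chains M F V X \<longleftrightarrow> (\<forall>t T i. \<forall>a \<in> controls V t T.
     0 \<le> t \<and> t \<le> T \<longrightarrow> markov_chain M F V a t T i (X T t i a))"

text \<open>
  Integral of an extended-real function as the difference of the integrals of its positive and
  negative parts (\<open>e2ennreal\<close> sends negative numbers to \<open>0\<close>).  Below, running costs are bounded
  below and payoffs are bounded above, so that \<open>\<infinity> - \<infinity>\<close> does not occur.
\<close>

definition ereal_integral :: "'a measure \<Rightarrow> ('a \<Rightarrow> ereal) \<Rightarrow> ereal" where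
  "ereal_integral M f =
     enn2ereal (\<integral>\<^sup>+ x. e2ennreal (f x) \<partial>M) - enn2ereal (\<integral>\<^sup>+ x. e2ennreal (- f x) \<partial>M)"

definition payoff ::
  "('n \<Rightarrow> 'n set) \<Rightarrow> ('n \<Rightarrow> ('n \<Rightarrow> real) \<Rightarrow> ereal) \<Rightarrow> ('n \<Rightarrow> real) \<Rightarrow> real \<Rightarrow> real \<Rightarrow> real
    \<Rightarrow> (real \<Rightarrow> 'n \<Rightarrow> 'n \<Rightarrow> real) \<Rightarrow> (real \<Rightarrow> 'n) \<Rightarrow> ereal" where
  "payoff V L g r T t a y =
     - ereal_integral (lebesgue_on {t..T})
         (\<lambda>s. ereal (exp (- r * (s - t))) * L (y s) (restrict (a s (y s)) (V (y s))))
     + ereal (exp (- r * (T - t)) * g (y T))"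

definition value_fn ::
  "'w measure \<Rightarrow> ('n \<Rightarrow> 'n set) \<Rightarrow> ('n \<Rightarrow> ('n \<Rightarrow> real) \<Rightarrow> ereal) \<Rightarrow> ('n \<Rightarrow> real)
    \<Rightarrow> (real \<Rightarrow> real \<Rightarrow> 'n \<Rightarrow> (real \<Rightarrow> 'n \<Rightarrow> 'n \<Rightarrow> real) \<Rightarrow> real \<Rightarrow> 'w \<Rightarrow> 'n)
    \<Rightarrow> real \<Rightarrow> real \<Rightarrow> 'n \<Rightarrow> real \<Rightarrow> ereal" where
  "value_fn M V L g X T r i t =
     (SUP a \<in> controls V t T.
        ereal_integral M (\<lambda>\<omega>. payoff V L g r T t a (\<lambda>s. X T t i a s \<omega>)))"

text \<open>
  For \<open>r > 0\<close> the limit exists, is finite, and is the same for every initial time \<open>t \<ge> 0\<close>; the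
  initial time is fixed to be \<open>0\<close>.
\<close>

definition stationary_value ::
  "'w measure \<Rightarrow> ('n \<Rightarrow> 'n set) \<Rightarrow> ('n \<Rightarrow> ('n \<Rightarrow> real) \<Rightarrow> ereal) \<Rightarrow> ('n \<Rightarrow> real)
    \<Rightarrow> (real \<Rightarrow> real \<Rightarrow> 'n \<Rightarrow> (real \<Rightarrow> 'n \<Rightarrow> 'n \<Rightarrow> real) \<Rightarrow> real \<Rightarrow> 'w \<Rightarrow> 'n)
    \<Rightarrow> real \<Rightarrow> 'n \<Rightarrow> ereal" where
  "stationary_value M V L g X r i = Lim at_top (\<lambda>T. value_fn M V L g X T r i 0)"

definition is_ergodic_constant ::
  "'w measure \<Rightarrow> ('n \<Rightarrow> 'n set) \<Rightarrow> ('n \<Rightarrow> ('n \<Rightarrow> real) \<Rightarrow> ereal) \<Rightarrow> ('n \<Rightarrow> real)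
    \<Rightarrow> (real \<Rightarrow> real \<Rightarrow> 'n \<Rightarrow> (real \<Rightarrow> 'n \<Rightarrow> 'n \<Rightarrow> real) \<Rightarrow> real \<Rightarrow> 'w \<Rightarrow> 'n)
    \<Rightarrow> real \<Rightarrow> bool" where
  "is_ergodic_constant M V L g X \<gamma> \<longleftrightarrow>
     (\<forall>i. ((\<lambda>r. ereal r * stationary_value M V L g X r i) \<longlongrightarrow> ereal \<gamma>) (at_right 0))"

end

theory Submission
  imports Defs
begin

text \<open>
  At a node where \<open>w - v\<close> is maximal, the increments of \<open>w\<close> towards the successors are at most those
  of \<open>v\<close>.  The Hamiltonian has the same value at both families of increments, so strict monotonicity
  forces them to coincide: the maximality passes to every successor, hence to all nodes.
\<close>

text \<open>Intensities are non-negative, so each term under the supremum is monotone in the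
  increments.\<close>

lemma hamiltonian_mono:
  assumes "\<And>j. j \<in> V i \<Longrightarrow> p j \<le> q j"
  shows "hamiltonian V L i p \<le> hamiltonian V L i q"
proof -
  have "ereal (\<Sum>j\<in>V i. l j * p j) - L i l \<le> ereal (\<Sum>j\<in>V i. l j * q j) - L i l"
    if "l \<in> intensities V i" for l
  proof (rule ereal_minus_mono)
    have "(\<Sum>j\<in>V i. l j * p j) \<le> (\<Sum>j\<in>V i. l j * q j)"
      using that assms by (intro sum_mono mult_left_mono) (auto simp: intensities_def PiE_iff)
    then show "ereal (\<Sum>j\<in>V i. l j * p j) \<le> ereal (\<Sum>j\<in>V i. l j * q j)" by simp
  qed simp
  then show ?thesis
    unfolding hamiltonian_def by (intro SUP_mono) blast
qed

text \<open>Strictness is given one coordinate at a time. The tuple \<open>q(k := p k)\<close>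
  separates the two effects: weak monotonicity handles the other coordinates, then only coordinate
  \<open>k\<close> is raised.\<close>

lemma hamiltonian_strict_mono:
  assumes le: "\<And>j. j \<in> V i \<Longrightarrow> p j \<le> q j"
    and k: "k \<in> V i" "p k < q k"
    and mono: "\<And>p j. j \<in> V i \<Longrightarrow> strict_mono (\<lambda>x. hamiltonian V L i (p(j := x)))"
  shows "hamiltonian V L i p < hamiltonian V L i q"
proof -
  have "hamiltonian V L i p \<le> hamiltonian V L i (q(k := p k))"
    using le by (intro hamiltonian_mono) auto
  \<comment> \<open>\<open>q(k := q k)\<close> is \<open>q\<close>, written so that both sides are
    values of one function of coordinate \<open>k\<close>.\<close>
  also have "\<dots> < hamiltonian V L i (q(k := q k))"
    using strict_monoD[OF mono[OF k(1)] k(2)] .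
  finally show ?thesis by simp
qed

theorem proposition6:
  fixes V :: "'n::finite \<Rightarrow> 'n set"
    and L :: "'n \<Rightarrow> ('n \<Rightarrow> real) \<Rightarrow> ereal"
    and g :: "'n \<Rightarrow> real"
    and M :: "'w measure"
    and F :: "real \<Rightarrow> 'w measure"
    and X :: "real \<Rightarrow> real \<Rightarrow> 'n \<Rightarrow> (real \<Rightarrow> 'n \<Rightarrow> 'n \<Rightarrow> real) \<Rightarrow> real \<Rightarrow> 'w \<Rightarrow> 'n"
    and \<gamma> :: real
    and v w :: "'n \<Rightarrow> real"
  assumes graph: "controlled_graph V L"
    and prob: "usual_filtered_prob_space M F"
    and chains: "controlled_chains M F V X"
    and strictly_increasing:
      "\<And>i p j. j \<in> V i \<Longrightarrow> strict_mono (\<lambda>x. hamiltonian V L i (p(j := x)))"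
    and ergodic: "is_ergodic_constant M V L g X \<gamma>"
    and v: "\<And>i. - ereal \<gamma> + hamiltonian V L i (\<lambda>j. v j - v i) = 0"
    and w: "\<And>i. - ereal \<gamma> + hamiltonian V L i (\<lambda>j. w j - w i) = 0"
  shows "\<exists>C::real. \<forall>i. w i = v i + C"
proof -
  \<comment> \<open>This maximum, attained as there are finitely many nodes, turns out to be the
    constant \<open>C\<close>.\<close>
  define m where "m = Max (range (\<lambda>i. w i - v i))"
  have le_m: "w i - v i \<le> m" for i
    unfolding m_def by (intro Max_ge) auto
  have "m \<in> range (\<lambda>i. w i - v i)"
    unfolding m_def by (intro Max_in) auto
  then obtain i0 where i0: "w i0 - v i0 = m" by auto
  have eq: "hamiltonian V L i (\<lambda>j. w j - w i) = hamiltonian V L i (\<lambda>j. v j - v i)" for i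
  proof -
    have "- ereal \<gamma> + hamiltonian V L i (\<lambda>j. w j - w i) =
        - ereal \<gamma> + hamiltonian V L i (\<lambda>j. v j - v i)"
      using v w by simp
    \<comment> \<open>Cancelling in \<open>ereal\<close> is sound because
      \<open>- ereal \<gamma>\<close> is finite.\<close>
    then show ?thesis by (simp add: ereal_add_cancel_left)
  qed
  have step: "w k - v k = m" if i: "w i - v i = m" and k: "k \<in> V i" for i k
  proof (rule ccontr)
    assume "w k - v k \<noteq> m"
    \<comment> \<open>Subtracting \<open>w i - v i = m\<close> from \<open>w k - v k < m\<close>
      gives a comparison of increments.\<close>
    with le_m[of k] i have "w k - w i < v k - v i" by linarith
    moreover have "w j - w i \<le> v j - v i" for j
      using le_m[of j] i by linarith
    ultimately have "hamiltonian V L i (\<lambda>j. w j - w i) < hamiltonian V L i (\<lambda>j. v j - v i)"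
      using k by (intro hamiltonian_strict_mono[OF _ _ _ strictly_increasing]) auto
    with eq show False by simp
  qed
  have "w i - v i = m" for i
  proof -
    have "(i0, i) \<in> {(k, l). l \<in> V k}\<^sup>*"
      using graph by (rule controlled_graph.strongly_connected)
    \<comment> \<open>The path from \<open>i0\<close> is extended at its end, so \<open>step\<close>
      carries the value \<open>m\<close> along each new edge.\<close>
    then show ?thesis
      by (induction rule: rtrancl_induct) (use i0 step in auto)
  qed
  then have "w i = v i + m" for i
    by (metis add.commute diff_add_cancel)
  then show ?thesis by blast
qed

end
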